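(* Let $B$ be a fixed finite complete gate basis in which every gate has unit cost. Then there is a constant $c_B$, depending only on $B$, such that for every $n \ge 1$ and any two Boolean functions $f, f' \colon \{0,1\}^n \to \{0,1\}$, \[ |\mathrm{opt}(f, B) - \mathrm{opt}(f', B)| \;\le\; c_B \cdot n \cdot d_H(\mathrm{tt}(f), \mathrm{tt}(f')). \]
   Context: The truth table $\mathrm{tt}(f)$ of $f\colon\{0,1\}^n\to\{0,1\}$ is the binary string of length $2^n$ listing the values of $f$ in lexicographic order of inputs; $d_H$ denotes Hamming distance between such strings (number of positions where they differ). A circuit over a gate basis $B$ is a directed acyclic graph whose sources are the input variables $x_0,\dots,x_{n-1}$ and whose internal nodes are labelled by gates from $B$; its size is the number of internal nodes (gates). $\mathrm{opt}(f,B)$ is the minimum size of a circuit over $B$ computing $f$. A basis is complete if every Boolean function is computable by a circuit over it. *)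

theory Defs
  imports Complex_Main
begin

text \<open>
  Bits are booleans, a point of \<open>{0,1}\<^sup>n\<close> is a list of length \<open>n\<close>, and a function on
  \<open>{0,1}\<^sup>n\<close> is represented by any \<open>f :: bool list \<Rightarrow> bool\<close>; its values on lists of other
  lengths are never inspected.
\<close>

text \<open>\<^const>\<open>product_lists\<close> enumerates in lexicographic order, with \<^const>\<open>False\<close> before \<^const>\<open>True\<close>.\<close>

definition tt :: "nat \<Rightarrow> (bool list \<Rightarrow> bool) \<Rightarrow> bool list" where
  "tt n f = map f (product_lists (replicate n [False, True]))"

definition hamming_dist :: "'a list \<Rightarrow> 'a list \<Rightarrow> nat" where
  "hamming_dist xs ys = card {i. i < length xs \<and> xs ! i \<noteq> ys ! i}"

text \<open>Arity 0, i.e. constant gates, is allowed; a basis need not contain any.\<close>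

datatype gate = Gate (arity: nat) (gate_fun: "bool list \<Rightarrow> bool")

datatype node = Input nat | Internal nat

text \<open>
  The predecessors of an internal node form a list, since gates need not be symmetric and
  may receive the same node more than once. The output may be an input node, so
  projections have circuits of size 0.
\<close>

record circuit =
  internal :: "nat set"
  label :: "nat \<Rightarrow> gate"
  preds :: "nat \<Rightarrow> node list"
  out_node :: node

definition nodes :: "nat \<Rightarrow> circuit \<Rightarrow> node set" where
  "nodes n C = Input ` {..<n} \<union> Internal ` internal C"

definition edges :: "circuit \<Rightarrow> (node \<times> node) set" where
  "edges C = {(u, Internal v) | u v. v \<in> internal C \<and> u \<in> set (preds C v)}"

definition is_circuit :: "gate set \<Rightarrow> nat \<Rightarrow> circuit \<Rightarrow> bool" where
  "is_circuit B n C \<longleftrightarrow>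
     finite (internal C) \<and>
     (\<forall>v \<in> internal C. label C v \<in> B \<and> length (preds C v) = arity (label C v) \<and>
        set (preds C v) \<subseteq> nodes n C) \<and>
     out_node C \<in> nodes n C \<and>
     acyclic (edges C)"

definition circuit_size :: "circuit \<Rightarrow> nat" where
  "circuit_size C = card (internal C)"

inductive has_value :: "circuit \<Rightarrow> bool list \<Rightarrow> node \<Rightarrow> bool \<Rightarrow> bool"
  for C :: circuit and x :: "bool list" where
  input: "i < length x \<Longrightarrow> has_value C x (Input i) (x ! i)"
| internal: "v \<in> internal C \<Longrightarrow> list_all2 (has_value C x) (preds C v) bs \<Longrightarrow>
    has_value C x (Internal v) (gate_fun (label C v) bs)"

definition computes :: "nat \<Rightarrow> circuit \<Rightarrow> (bool list \<Rightarrow> bool) \<Rightarrow> bool" where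
  "computes n C f \<longleftrightarrow> (\<forall>x. length x = n \<longrightarrow> has_value C x (out_node C) (f x))"

text \<open>
  Only \<open>n \<ge> 1\<close> is required: without constant gates there is no circuit at all for \<open>n = 0\<close>,
  so this does not exclude bases such as NAND alone.
\<close>

definition complete_basis :: "gate set \<Rightarrow> bool" where
  "complete_basis B \<longleftrightarrow> (\<forall>n \<ge> 1. \<forall>f. \<exists>C. is_circuit B n C \<and> computes n C f)"

definition opt :: "nat \<Rightarrow> (bool list \<Rightarrow> bool) \<Rightarrow> gate set \<Rightarrow> nat" where
  "opt n f B = (LEAST s. \<exists>C. is_circuit B n C \<and> computes n C f \<and> circuit_size C = s)"

text \<open>In a circuit, every node has exactly one value on every input.\<close>

lemma has_value_unique: "has_value C x u b \<Longrightarrow> has_value C x u b' \<Longrightarrow> b = b'"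
proof (induction arbitrary: b' rule: has_value.induct)
  case (input i)
  then show ?case by (auto elim: has_value.cases)
next
  case (internal v bs)
  from internal.prems obtain bs' where b': "b' = gate_fun (label C v) bs'"
    and bs': "list_all2 (has_value C x) (preds C v) bs'"
    by (auto elim: has_value.cases)
  have "bs = bs'"
  proof (rule nth_equalityI)
    show "length bs = length bs'"
      using internal.IH bs' by (simp add: list_all2_conv_all_nth)
    show "bs ! i = bs' ! i" if "i < length bs" for i
      using internal.IH bs' that by (auto simp: list_all2_conv_all_nth)
  qed
  with b' show ?case by simp
qed

lemma has_value_exists:
  assumes C: "is_circuit B n C" and x: "length x = n" and u: "u \<in> nodes n C"
  shows "\<exists>b. has_value C x u b"
proof -
  have "edges C \<subseteq> (\<Union>v \<in> internal C. set (preds C v) \<times> {Internal v})"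
    by (auto simp: edges_def)
  moreover have "finite (\<Union>v \<in> internal C. set (preds C v) \<times> {Internal v})"
    using C by (simp add: is_circuit_def)
  ultimately have "finite (edges C)" by (rule finite_subset)
  then have "wf (edges C)" using C by (simp add: finite_acyclic_wf is_circuit_def)
  then show ?thesis using u
  proof (induction u rule: wf_induct_rule)
    case (less u)
    show ?case
    proof (cases u)
      case (Input i)
      then show ?thesis using less.prems x by (auto simp: nodes_def intro: has_value.input)
    next
      case (Internal v)
      then have v: "v \<in> internal C" using less.prems by (auto simp: nodes_def)
      have "\<exists>b. has_value C x w b" if "w \<in> set (preds C v)" for w
        using that v C Internal by (intro less.IH) (auto simp: edges_def is_circuit_def)
      then obtain g where "\<And>w. w \<in> set (preds C v) \<Longrightarrow> has_value C x w (g w)" by metis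
      then have "list_all2 (has_value C x) (preds C v) (map g (preds C v))"
        by (simp add: list_all2_conv_all_nth)
      then show ?thesis using v Internal has_value.internal by blast
    qed
  qed
qed

end

theory Submission
  imports Defs
begin

text \<open>
  Changing one value of \<open>f\<close>, at the point \<open>a\<close>, amounts to taking the exclusive or of \<open>f\<close> with the
  indicator of \<open>a\<close>. That indicator is a conjunction of \<open>n\<close> literals, so it costs \<open>O(n)\<close> binary
  operations, and by completeness each of these costs a constant number of gates of \<open>B\<close>. Changing
  the values one at a time gives the bound. Circuits are composed as straight-line programs, where
  only the set of functions computed so far matters, which avoids relabelling of nodes.
\<close>

section \<open>Straight-line programs and their composition\<close>

inductive slp :: "gate set \<Rightarrow> nat \<Rightarrow> nat \<Rightarrow> (bool list \<Rightarrow> bool) set \<Rightarrow> bool"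
  for B :: "gate set" and n :: nat where
  inputs: "slp B n 0 ((\<lambda>i x. x ! i) ` {..<n})"
| gate: "slp B n s H \<Longrightarrow> g \<in> B \<Longrightarrow> length hs = arity g \<Longrightarrow> set hs \<subseteq> H \<Longrightarrow>
    slp B n (Suc s) (insert (\<lambda>x. gate_fun g (map (\<lambda>h. h x) hs)) H)"

lemma slp_inputs_subset: "slp B n s H \<Longrightarrow> i < n \<Longrightarrow> (\<lambda>x. x ! i) \<in> H"
  by (induction rule: slp.induct) auto

text \<open>Substitution: the program over \<open>m\<close> inputs is replayed with
  \<open>ks\<close> as its inputs. Each of its gates is replayed once and its inputs are already in
  \<open>K\<close>, so the sizes add. Keeping \<open>K \<subseteq> K'\<close> leaves earlier results
  available.\<close>

lemma slp_compose:
  assumes "slp B m s H" "slp B n t K" "length ks = m" "set ks \<subseteq> K"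
  shows "\<exists>K'. slp B n (t + s) K' \<and> K \<subseteq> K' \<and> (\<forall>h \<in> H. (\<lambda>x. h (map (\<lambda>k. k x) ks)) \<in> K')"
  using assms(1)
proof (induction rule: slp.induct)
  case inputs
  have "(\<lambda>x. map (\<lambda>k. k x) ks ! i) \<in> K" if "i < m" for i
    using that assms(3,4) by (simp add: subset_iff)
  then show ?case using assms(2) by (intro exI[of _ K]) auto
next
  case (gate s H g hs)
  then obtain K' where K': "slp B n (t + s) K'" "K \<subseteq> K'"
    "\<And>h. h \<in> H \<Longrightarrow> (\<lambda>x. h (map (\<lambda>k. k x) ks)) \<in> K'" by blast
  let ?hs = "map (\<lambda>h x. h (map (\<lambda>k. k x) ks)) hs"
  have "slp B n (Suc (t + s)) (insert (\<lambda>x. gate_fun g (map (\<lambda>h. h x) ?hs)) K')"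
    using K' gate.hyps by (intro slp.gate) auto
  then show ?case using K'
    by (intro exI[of _ "insert (\<lambda>x. gate_fun g (map (\<lambda>h. h x) ?hs)) K'"]) (auto simp: comp_def)
qed

section \<open>Translation between programs and circuits\<close>

lemma has_value_mono:
  assumes "has_value C x u b" and "internal C \<subseteq> internal C'"
    and "\<And>v. v \<in> internal C \<Longrightarrow> label C' v = label C v \<and> preds C' v = preds C v"
  shows "has_value C' x u b"
  using assms(1)
proof (induction rule: has_value.induct)
  case (input i)
  then show ?case by (rule has_value.input)
next
  case (internal v bs)
  then have "list_all2 (has_value C' x) (preds C' v) bs"
    using assms(3) by (auto elim: list_all2_mono)
  then show ?case using has_value.internal[of v C' x bs] internal.hyps(1) assms(2,3) by auto
qed

text \<open>Gates are numbered in program order, so predecessors have smaller numbers, which later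
  yields acyclicity. The output node \<open>w\<close> stays arbitrary because it is fixed only once
  a function in \<open>H\<close> has been chosen; values do not depend on it.\<close>

lemma circuit_of_slp:
  assumes "slp B n s H"
  shows "\<exists>lab prd. (\<forall>v < s. lab v \<in> B \<and> length (prd v) = arity (lab v) \<and>
      set (prd v) \<subseteq> Input ` {..<n} \<union> Internal ` {..<v}) \<and>
    (\<forall>h \<in> H. \<exists>u \<in> Input ` {..<n} \<union> Internal ` {..<s}. \<forall>w x. length x = n \<longrightarrow>
      has_value \<lparr>internal = {..<s}, label = lab, preds = prd, out_node = w\<rparr> x u (h x))"
  using assms
proof (induction rule: slp.induct)
  case inputs
  show ?case by (force intro: has_value.input)
next
  case (gate s H g hs)
  then obtain lab prd where
    wf: "\<And>v. v < s \<Longrightarrow> lab v \<in> B \<and> length (prd v) = arity (lab v) \<and>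
      set (prd v) \<subseteq> Input ` {..<n} \<union> Internal ` {..<v}" and
    val: "\<forall>h \<in> H. \<exists>u \<in> Input ` {..<n} \<union> Internal ` {..<s}. \<forall>w x. length x = n \<longrightarrow>
      has_value \<lparr>internal = {..<s}, label = lab, preds = prd, out_node = w\<rparr> x u (h x)"
    by blast
  from val obtain node where node: "\<And>h. h \<in> H \<Longrightarrow> node h \<in> Input ` {..<n} \<union> Internal ` {..<s}"
    "\<And>h w x. h \<in> H \<Longrightarrow> length x = n \<Longrightarrow>
      has_value \<lparr>internal = {..<s}, label = lab, preds = prd, out_node = w\<rparr> x (node h) (h x)"
    by metis
  \<comment> \<open>The new gate gets the fresh number \<open>s\<close>, so the gates below
    \<open>s\<close>, and hence all old values, are untouched.\<close>
  let ?lab = "lab(s := g)" and ?prd = "prd(s := map node hs)"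
  let ?C = "\<lambda>w. \<lparr>internal = {..<Suc s}, label = ?lab, preds = ?prd, out_node = w\<rparr>"
  have old: "has_value (?C w) x (node h) (h x)" if "h \<in> H" "length x = n" for h w x
    by (rule has_value_mono[OF node(2)[OF that]]) auto
  have new: "has_value (?C w) x (Internal s) (gate_fun g (map (\<lambda>h. h x) hs))"
    if "length x = n" for w x
    using has_value.internal[of s "?C w" x "map (\<lambda>h. h x) hs"] old that gate.hyps(4)
    by (auto simp: list_all2_conv_all_nth subset_iff)
  have 1: "?lab v \<in> B \<and> length (?prd v) = arity (?lab v) \<and>
      set (?prd v) \<subseteq> Input ` {..<n} \<union> Internal ` {..<v}" if "v < Suc s" for v
  proof (cases "v = s")
    case True
    then show ?thesis using gate.hyps node(1) by fastforce
  next
    case False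
    then show ?thesis using wf that by simp
  qed
  have 2: "\<exists>u \<in> Input ` {..<n} \<union> Internal ` {..<Suc s}. \<forall>w x. length x = n \<longrightarrow>
      has_value (?C w) x u (h x)"
    if "h \<in> insert (\<lambda>x. gate_fun g (map (\<lambda>h. h x) hs)) H" for h
  \<comment> \<open>The new gate may compute a function that already lies in \<open>H\<close>; then
    the old node serves.\<close>
  proof (cases "h \<in> H")
    case True
    then have "node h \<in> Input ` {..<n} \<union> Internal ` {..<Suc s}" using node(1) by fastforce
    then show ?thesis using old True by blast
  next
    case False
    then show ?thesis using new that by (intro bexI[of _ "Internal s"]) auto
  qed
  show ?case using 1 2 by blast
qed

lemma slp_imp_circuit:
  assumes "slp B n s H" "h \<in> H"
  obtains C where "is_circuit B n C" "computes n C h" "circuit_size C = s"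
proof -
  obtain lab prd u where
    wf: "\<And>v. v < s \<Longrightarrow> lab v \<in> B \<and> length (prd v) = arity (lab v) \<and>
      set (prd v) \<subseteq> Input ` {..<n} \<union> Internal ` {..<v}" and
    u: "u \<in> Input ` {..<n} \<union> Internal ` {..<s}" and
    val: "\<And>w x. length x = n \<Longrightarrow>
      has_value \<lparr>internal = {..<s}, label = lab, preds = prd, out_node = w\<rparr> x u (h x)"
    using circuit_of_slp[OF assms(1)] assms(2) by metis
  let ?C = "\<lparr>internal = {..<s}, label = lab, preds = prd, out_node = u\<rparr>"
  \<comment> \<open>Rank 0 for inputs and \<open>Suc v\<close> for gate \<open>v\<close> makes every
    edge increase, including those from an input to gate 0.\<close>
  have "edges ?C \<subseteq> measure (case_node (\<lambda>_. 0) Suc)"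
    using wf by (fastforce simp: edges_def)
  then have "acyclic (edges ?C)"
    by (meson wf_acyclic wf_measure wf_subset)
  moreover have "set (prd v) \<subseteq> nodes n ?C" if "v < s" for v
    using wf[OF that] that by (fastforce simp: nodes_def)
  ultimately have "is_circuit B n ?C"
    using wf u by (simp add: is_circuit_def nodes_def)
  then show ?thesis
    using val that[of ?C] by (simp add: computes_def circuit_size_def)
qed

text \<open>The gates are listed in topological order: a minimal node outside \<open>S\<close> comes next.\<close>

lemma slp_of_circuit:
  assumes C: "is_circuit B n C" and "k \<le> circuit_size C"
  shows "\<exists>S H. S \<subseteq> internal C \<and> card S = k \<and> slp B n k H \<and>
    (\<forall>u \<in> Input ` {..<n} \<union> Internal ` S. \<exists>h \<in> H. \<forall>x. length x = n \<longrightarrow> has_value C x u (h x))"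
  using assms(2)
proof (induction k)
  case 0
  show ?case
    by (intro exI[of _ "{}"] exI[of _ "(\<lambda>i x. x ! i) ` {..<n}"])
      (auto intro: has_value.input slp.inputs)
next
  case (Suc k)
  have fin: "finite (internal C)" using C by (simp add: is_circuit_def)
  have "edges C \<subseteq> (\<Union>v \<in> internal C. set (preds C v) \<times> {Internal v})"
    by (auto simp: edges_def)
  then have "finite (edges C)" using fin by (auto intro: finite_subset)
  then have wf: "wf (edges C)" using C by (simp add: finite_acyclic_wf is_circuit_def)
  obtain S H where S: "S \<subseteq> internal C" "card S = k" and H: "slp B n k H"
    and val: "\<forall>u \<in> Input ` {..<n} \<union> Internal ` S.
      \<exists>h \<in> H. \<forall>x. length x = n \<longrightarrow> has_value C x u (h x)"
    using Suc by auto
  from val obtain fn where fn: "\<And>u. u \<in> Input ` {..<n} \<union> Internal ` S \<Longrightarrow> fn u \<in> H"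
    "\<And>u x. u \<in> Input ` {..<n} \<union> Internal ` S \<Longrightarrow> length x = n \<Longrightarrow> has_value C x u (fn u x)"
    by metis
  have "S \<noteq> internal C" using S(2) Suc.prems by (auto simp: circuit_size_def)
  then obtain v0 where "Internal v0 \<in> Internal ` (internal C - S)" using S(1) by blast
  with wf obtain z where z: "z \<in> Internal ` (internal C - S)"
    and min: "\<And>y. (y, z) \<in> edges C \<Longrightarrow> y \<notin> Internal ` (internal C - S)"
    by (rule wfE_min) blast
  from z obtain v where v: "z = Internal v" "v \<in> internal C" "v \<notin> S" by blast
  have prd: "set (preds C v) \<subseteq> Input ` {..<n} \<union> Internal ` S"
  proof
    fix u assume u: "u \<in> set (preds C v)"
    then have "u \<in> nodes n C" using C v by (auto simp: is_circuit_def)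
    moreover have "u \<notin> Internal ` (internal C - S)"
      using u v min by (auto simp: edges_def)
    ultimately show "u \<in> Input ` {..<n} \<union> Internal ` S" by (auto simp: nodes_def)
  qed
  let ?g = "\<lambda>x. gate_fun (label C v) (map (\<lambda>h. h x) (map fn (preds C v)))"
  \<comment> \<open>The counter grows even if \<open>?g\<close> is already in \<open>H\<close>, so
    the program length is exactly the number of listed gates.\<close>
  have "slp B n (Suc k) (insert ?g H)"
    using C v(2) prd fn(1) by (intro slp.gate[OF H]) (auto simp: is_circuit_def)
  moreover have "has_value C x (Internal v) (?g x)" if "length x = n" for x
    using prd fn(2) that v(2)
    by (intro has_value.internal) (auto simp: list_all2_conv_all_nth subset_iff)
  moreover have "card (insert v S) = Suc k"
    using S v(3) fin by (simp add: finite_subset)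
  ultimately show ?case using S(1) v(2) val
    by (intro exI[of _ "insert v S"] exI[of _ "insert ?g H"]) auto
qed

text \<open>With \<open>k\<close> the full size, all gates are listed, so the output node is
  covered, and uniqueness of values identifies its function with \<open>f\<close>. Members of
  \<open>H\<close> are functions on all lists, so agreement with \<open>f\<close> is claimed only at
  length \<open>n\<close>.\<close>

lemma circuit_imp_slp:
  assumes C: "is_circuit B n C" and f: "computes n C f"
  obtains H h where "slp B n (circuit_size C) H" "h \<in> H" "\<And>x. length x = n \<Longrightarrow> h x = f x"
proof -
  obtain S H where S: "S \<subseteq> internal C" "card S = card (internal C)"
    and H: "slp B n (circuit_size C) H"
    and val: "\<forall>u \<in> Input ` {..<n} \<union> Internal ` S.
      \<exists>h \<in> H. \<forall>x. length x = n \<longrightarrow> has_value C x u (h x)"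
    using slp_of_circuit[OF C order_refl] by (auto simp: circuit_size_def)
  have "S = internal C" using S C by (simp add: card_subset_eq is_circuit_def)
  then have "out_node C \<in> Input ` {..<n} \<union> Internal ` S"
    using C by (simp add: is_circuit_def nodes_def)
  then obtain h where "h \<in> H" "\<And>x. length x = n \<Longrightarrow> has_value C x (out_node C) (h x)"
    using val by blast
  then show ?thesis using that[OF H] f by (metis computes_def has_value_unique)
qed

section \<open>Optimal size in terms of programs\<close>

lemma opt_le_slp:
  assumes "slp B n s H" "h \<in> H" "\<And>x. length x = n \<Longrightarrow> h x = f x"
  shows "opt n f B \<le> s"
proof -
  obtain C where "is_circuit B n C" "computes n C h" "circuit_size C = s"
    using slp_imp_circuit assms(1,2) .
  then show ?thesis
    unfolding opt_def using assms(3) by (intro Least_le) (auto simp: computes_def)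
qed

text \<open>Completeness supplies at least one circuit, so the least size is attained.\<close>

lemma slp_opt:
  assumes "complete_basis B" "n \<ge> 1"
  obtains H h where "slp B n (opt n f B) H" "h \<in> H" "\<And>x. length x = n \<Longrightarrow> h x = f x"
proof -
  have "\<exists>s C. is_circuit B n C \<and> computes n C f \<and> circuit_size C = s"
    using assms by (auto simp: complete_basis_def)
  then have "\<exists>C. is_circuit B n C \<and> computes n C f \<and> circuit_size C = opt n f B"
    unfolding opt_def by (rule LeastI_ex)
  then show ?thesis using circuit_imp_slp that by metis
qed

section \<open>Cost of changing a single value\<close>

lemma slp_binary_op:
  fixes p :: "bool \<Rightarrow> bool \<Rightarrow> bool"
  assumes "complete_basis B" "slp B n t K" "k1 \<in> K" "k2 \<in> K"
  obtains K' where "slp B n (t + opt 2 (\<lambda>y. p (y ! 0) (y ! 1)) B) K'" "K \<subseteq> K'"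
    "(\<lambda>x. p (k1 x) (k2 x)) \<in> K'"
proof -
  \<comment> \<open>An optimal program for \<open>p\<close> on two variables will be run on
    \<open>k1\<close> and \<open>k2\<close>. Its size does not involve \<open>n\<close>, which is
    why the final constant depends on \<open>B\<close> alone.\<close>
  obtain H h where H: "slp B 2 (opt 2 (\<lambda>y. p (y ! 0) (y ! 1)) B) H" "h \<in> H"
    and h: "\<And>y. length y = 2 \<Longrightarrow> h y = p (y ! 0) (y ! 1)"
    using slp_opt[OF assms(1), of 2 "\<lambda>y. p (y ! 0) (y ! 1)"] by auto
  obtain K' where "slp B n (t + opt 2 (\<lambda>y. p (y ! 0) (y ! 1)) B) K'" "K \<subseteq> K'"
    "(\<lambda>x. h (map (\<lambda>k. k x) [k1, k2])) \<in> K'"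
    using slp_compose[OF H(1) assms(2), of "[k1, k2]"] assms(3,4) H(2) by auto
  then show ?thesis using that h by simp
qed

text \<open>Literal and conjunction are merged into one binary operation
  \<open>y \<and> z = b\<close>, so negations are not paid separately. One operation per coordinate
  and one for the initial constant give the factor \<open>Suc k\<close>.\<close>

lemma slp_prefix_eq:
  fixes B n
  defines "cost p \<equiv> opt 2 (\<lambda>y. p (y ! 0) (y ! 1)) B"
  assumes B: "complete_basis B" and n: "n \<ge> 1" and H: "slp B n t H" and "k \<le> n"
    and true: "cost (\<lambda>_ _. True) \<le> M" and conj: "\<And>b. cost (\<lambda>y z. y \<and> z = b) \<le> M"
  shows "\<exists>s H'. s \<le> t + Suc k * M \<and> slp B n s H' \<and> H \<subseteq> H' \<and> (\<lambda>x. \<forall>i < k. x ! i = a ! i) \<in> H'"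
  using \<open>k \<le> n\<close>
proof (induction k)
  case 0
  \<comment> \<open>The basis may lack constant gates, so True is built as a binary operation on two
    copies of input 0, which exists since \<open>n \<ge> 1\<close>.\<close>
  have x0: "(\<lambda>x. x ! 0) \<in> H" using slp_inputs_subset[OF H] n by simp
  obtain H' where "slp B n (t + cost (\<lambda>_ _. True)) H'" "H \<subseteq> H'" "(\<lambda>x. True) \<in> H'"
    unfolding cost_def by (rule slp_binary_op[OF B H x0 x0, where p = "\<lambda>_ _. True"])
  then show ?case using true by (intro exI[of _ "t + cost (\<lambda>_ _. True)"] exI[of _ H']) simp
next
  case (Suc k)
  then obtain s H1 where s: "s \<le> t + Suc k * M" and H1: "slp B n s H1" "H \<subseteq> H1"
    and pre: "(\<lambda>x. \<forall>i < k. x ! i = a ! i) \<in> H1" by auto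
  have "(\<lambda>x. x ! k) \<in> H1" using slp_inputs_subset[OF H1(1)] Suc.prems by simp
  with pre obtain H' where "slp B n (s + cost (\<lambda>y z. y \<and> z = a ! k)) H'" "H1 \<subseteq> H'"
    "(\<lambda>x. (\<forall>i < k. x ! i = a ! i) \<and> x ! k = a ! k) \<in> H'"
    unfolding cost_def by (rule slp_binary_op[OF B H1(1), where p = "\<lambda>y z. y \<and> z = a ! k"])
  moreover have "s + cost (\<lambda>y z. y \<and> z = a ! k) \<le> t + Suc (Suc k) * M"
    using s conj[of "a ! k"] by simp
  moreover have "(\<lambda>x. (\<forall>i < k. x ! i = a ! i) \<and> x ! k = a ! k) = (\<lambda>x. \<forall>i < Suc k. x ! i = a ! i)"
    by (auto simp: less_Suc_eq)
  ultimately show ?case using H1(2)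
    by (intro exI[of _ "s + cost (\<lambda>y z. y \<and> z = a ! k)"] exI[of _ H']) auto
qed

lemma opt_change_one_value:
  assumes B: "complete_basis B"
  obtains c where "\<And>n f f' a. n \<ge> 1 \<Longrightarrow> length a = n \<Longrightarrow>
    (\<And>x. length x = n \<Longrightarrow> f' x = (f x \<noteq> (x = a))) \<Longrightarrow> opt n f' B \<le> opt n f B + c * n"
proof -
  define cost where "cost p = opt 2 (\<lambda>y. p (y ! 0) (y ! 1)) B" for p :: "bool \<Rightarrow> bool \<Rightarrow> bool"
  \<comment> \<open>The sum is a common bound for the four operations used, fixed before
    \<open>n\<close> and \<open>f\<close>.\<close>
  define M where "M = cost (\<lambda>_ _. True) + cost (\<lambda>y z. y \<and> z = True) +
    cost (\<lambda>y z. y \<and> z = False) + cost (\<noteq>)"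
  have M: "cost (\<lambda>_ _. True) \<le> M" "cost (\<lambda>y z. y \<and> z = b) \<le> M" "cost (\<noteq>) \<le> M" for b
    by (cases b; simp add: M_def)+
  \<comment> \<open>The indicator of \<open>a\<close> takes \<open>Suc n\<close> operations and the
    exclusive or one more; \<open>n + 2 \<le> 3 * n\<close> because
    \<open>n \<ge> 1\<close>.\<close>
  have "opt n f' B \<le> opt n f B + (3 * M) * n"
    if n: "n \<ge> 1" and a: "length a = n" and f': "\<And>x. length x = n \<Longrightarrow> f' x = (f x \<noteq> (x = a))"
    for n f f' a
  proof -
    obtain H h where H: "slp B n (opt n f B) H" "h \<in> H" and h: "\<And>x. length x = n \<Longrightarrow> h x = f x"
      using slp_opt[OF B n, of f] by blast
    obtain s H1 where s: "s \<le> opt n f B + Suc n * M" and H1: "slp B n s H1" "H \<subseteq> H1"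
      and e: "(\<lambda>x. \<forall>i < n. x ! i = a ! i) \<in> H1"
      using slp_prefix_eq[OF B n H(1) order_refl M(1,2)[unfolded cost_def], of a] by blast
    have "h \<in> H1" using H(2) H1(2) by blast
    from this e obtain H2 where H2: "slp B n (s + cost (\<noteq>)) H2"
      "(\<lambda>x. h x \<noteq> (\<forall>i < n. x ! i = a ! i)) \<in> H2"
      unfolding cost_def by (rule slp_binary_op[OF B H1(1), where p = "(\<noteq>)"])
    \<comment> \<open>At length \<open>n\<close>, agreeing with \<open>a\<close> on the first
      \<open>n\<close> positions is equality with \<open>a\<close>.\<close>
    have "(h x \<noteq> (\<forall>i < n. x ! i = a ! i)) = f' x" if "length x = n" for x
      using that h f' a by (simp add: list_eq_iff_nth_eq)
    then have "opt n f' B \<le> s + cost (\<noteq>)" using opt_le_slp[OF H2] by blast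
    also have "\<dots> \<le> opt n f B + (n + 2) * M" using s M(3) by simp
    also have "\<dots> \<le> opt n f B + (3 * n) * M" using n by (intro add_left_mono mult_right_mono) auto
    finally show ?thesis by (simp add: mult_ac)
  qed
  then show ?thesis by (rule that)
qed

section \<open>From one point to the Hamming distance\<close>

lemma finite_bool_lists_length: "finite {x :: bool list. length x = n}"
  using finite_lists_length_eq[of "UNIV :: bool set" n] by simp

text \<open>\<open>f\<close> is moved towards the fixed \<open>f'\<close> one differing point at a
  time, each move costing at most \<open>c\<close>.\<close>

lemma opt_le_opt_plus_card:
  assumes one: "\<And>f f' a. length a = n \<Longrightarrow>
    (\<And>x. length x = n \<Longrightarrow> f' x = (f x \<noteq> (x = a))) \<Longrightarrow> opt n f' B \<le> opt n f B + c"
  shows "opt n f' B \<le> opt n f B + c * card {x. length x = n \<and> f x \<noteq> f' x}"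
proof (induction "card {x. length x = n \<and> f x \<noteq> f' x}" arbitrary: f)
  case 0
  then have "{x. length x = n \<and> f x \<noteq> f' x} = {}"
    using finite_bool_lists_length[of n] by simp
  \<comment> \<open>\<open>f\<close> and \<open>f'\<close> may still differ on lists of other
    lengths; \<open>computes\<close> ignores these, hence so does \<open>opt\<close>.\<close>
  then have "computes n C f = computes n C f'" for C
    by (auto simp: computes_def)
  then show ?case by (simp add: opt_def)
next
  case (Suc d)
  let ?D = "\<lambda>f. {x. length x = n \<and> f x \<noteq> f' x}"
  from Suc.hyps(2) have "?D f \<noteq> {}" by (metis card.empty nat.distinct(1))
  then obtain a where a: "a \<in> ?D f" by blast
  \<comment> \<open>Values are Boolean, so overwriting \<open>f\<close> at a differing point is a
    flip, as \<open>one\<close> demands.\<close>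
  define g where "g = f(a := f' a)"
  have "?D g = ?D f - {a}" by (auto simp: g_def)
  then have d: "card (?D g) = d" using a Suc.hyps(2) by (simp add: card_Diff_singleton)
  have "opt n f' B \<le> opt n g B + c * d" using Suc.hyps(1)[of g] d by simp
  moreover have "opt n g B \<le> opt n f B + c"
    by (rule one[of a]) (use a in \<open>auto simp: g_def\<close>)
  ultimately show ?case using Suc.hyps(2)[symmetric] by simp
qed

text \<open>Every point occurs somewhere in the lexicographic enumeration, so the differing
  positions map onto the differing points.\<close>

lemma card_differing_le_hamming_dist:
  "card {x. length x = n \<and> f x \<noteq> f' x} \<le> hamming_dist (tt n f) (tt n f')"
proof -
  let ?L = "product_lists (replicate n [False, True])"
  let ?I = "{i. i < length (tt n f) \<and> tt n f ! i \<noteq> tt n f' ! i}"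
  have "{x. length x = n \<and> f x \<noteq> f' x} \<subseteq> (!) ?L ` ?I"
  proof
    fix x assume x: "x \<in> {x. length x = n \<and> f x \<noteq> f' x}"
    then have "x \<in> set ?L" by (simp add: product_lists_set list_all2_conv_all_nth)
    then obtain i where "i < length ?L" "?L ! i = x" by (meson in_set_conv_nth)
    with x show "x \<in> (!) ?L ` ?I" by (intro image_eqI[of _ _ i]) (auto simp: tt_def)
  qed
  then have "card {x. length x = n \<and> f x \<noteq> f' x} \<le> card ?I"
    by (intro surj_card_le) auto
  then show ?thesis by (simp add: hamming_dist_def)
qed

theorem theorem1:
  fixes B :: "gate set"
  assumes "finite B" and "complete_basis B"
  shows "\<exists>c :: real. \<forall>n \<ge> 1. \<forall>f f' :: bool list \<Rightarrow> bool.
    \<bar>real (opt n f B) - real (opt n f' B)\<bar> \<le> c * real n * real (hamming_dist (tt n f) (tt n f'))"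
proof -
  obtain c where c: "\<And>n f f' a. n \<ge> 1 \<Longrightarrow> length a = n \<Longrightarrow>
    (\<And>x. length x = n \<Longrightarrow> f' x = (f x \<noteq> (x = a))) \<Longrightarrow> opt n f' B \<le> opt n f B + c * n"
    using opt_change_one_value[OF assms(2)] by blast
  \<comment> \<open>For fixed \<open>n\<close>, the price per changed point is
    \<open>c * n\<close>.\<close>
  have le: "opt n f' B \<le> opt n f B + c * n * card {x. length x = n \<and> f x \<noteq> f' x}"
    if "n \<ge> 1" for n f f'
    by (rule opt_le_opt_plus_card) (rule c[OF that])
  have "\<bar>real (opt n f B) - real (opt n f' B)\<bar> \<le>
      real c * real n * real (hamming_dist (tt n f) (tt n f'))" if "n \<ge> 1" for n f f'
  proof -
    let ?d = "card {x. length x = n \<and> f x \<noteq> f' x}"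
    \<comment> \<open>The set of differing points is symmetric in \<open>f\<close> and
      \<open>f'\<close>, so one estimate serves both directions.\<close>
    have "opt n f' B \<le> opt n f B + c * n * ?d" "opt n f B \<le> opt n f' B + c * n * ?d"
      using le[OF that, of f' f] le[OF that, of f f'] by (simp_all add: eq_commute)
    moreover have "c * n * ?d \<le> c * n * hamming_dist (tt n f) (tt n f')"
      by (rule mult_left_mono[OF card_differing_le_hamming_dist]) simp
    ultimately have "opt n f' B \<le> opt n f B + c * n * hamming_dist (tt n f) (tt n f')"
      "opt n f B \<le> opt n f' B + c * n * hamming_dist (tt n f) (tt n f')" by linarith+
    then have "real (opt n f' B) \<le> real (opt n f B + c * n * hamming_dist (tt n f) (tt n f'))"
      "real (opt n f B) \<le> real (opt n f' B + c * n * hamming_dist (tt n f) (tt n f'))"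
      by (simp_all only: of_nat_le_iff)
    then show ?thesis by simp
  qed
  then show ?thesis by blast
qed

end
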